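(* Let $p,q$ be complex numbers. The generating function of the even-indexed $(p,q)$-Fibonacci numbers is, as a formal power series in $z$, $$\sum_{n=0}^{\infty}F_{p,q,2n}z^n=\frac{pz}{1-(p^2+2q)z+q^2z^2}.$$
   Context: The $(p,q)$-Fibonacci numbers are defined by $F_{p,q,0}=0$, $F_{p,q,1}=1$, and $F_{p,q,n}=pF_{p,q,n-1}+qF_{p,q,n-2}$ for $n\ge 2$. *)

theory Defs
  imports Complex_Main "HOL-Computational_Algebra.Formal_Power_Series"
begin

fun pq_fib :: "complex \<Rightarrow> complex \<Rightarrow> nat \<Rightarrow> complex" where
  "pq_fib p q 0 = 0"
| "pq_fib p q (Suc 0) = 1"
| "pq_fib p q (Suc (Suc n)) = p * pq_fib p q (Suc n) + q * pq_fib p q n"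

end

theory Submission
  imports Defs
begin

text \<open>The even-indexed terms satisfy a second-order recurrence of their own: if a and b are
  the roots of x^2 - p x - q, their squares have sum p^2 + 2q and product q^2. Multiplying the
  series by the denominator therefore kills every coefficient from z^2 on, and the two initial
  values leave p z.\<close>

lemma pq_fib_bisection:
  "pq_fib p q (n + 4) = (p\<^sup>2 + 2 * q) * pq_fib p q (n + 2) - q\<^sup>2 * pq_fib p q n"
proof -
  have "pq_fib p q (n + 2) = p * pq_fib p q (n + 1) + q * pq_fib p q n"
    and "pq_fib p q (n + 3) = p * pq_fib p q (n + 2) + q * pq_fib p q (n + 1)"
    and "pq_fib p q (n + 4) = p * pq_fib p q (n + 3) + q * pq_fib p q (n + 2)"
    by (simp_all add: eval_nat_numeral)
  \<comment> \<open>Eliminate the terms at n + 1 and n + 3 from the three instances; no division by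
    p is needed.\<close>
  then show ?thesis
    by algebra
qed

theorem proposition2:
  fixes p q :: complex
  shows "Abs_fps (\<lambda>n. pq_fib p q (2 * n)) =
    (fps_const p * fps_X) /
      (1 - fps_const (p\<^sup>2 + 2 * q) * fps_X + fps_const (q\<^sup>2) * fps_X\<^sup>2)"
proof -
  define s t where "s = p\<^sup>2 + 2 * q" and "t = q\<^sup>2"
  define A where "A = Abs_fps (\<lambda>n. pq_fib p q (2 * n))"
  define D where "D = 1 - fps_const s * fps_X + fps_const t * fps_X\<^sup>2"
  have D0: "fps_nth D 0 = 1"
    by (simp add: D_def)
  have "A * D = A - fps_const s * (fps_X * A) + fps_const t * (fps_X\<^sup>2 * A)"
    unfolding D_def by algebra
  \<comment> \<open>Multiplying by \<open>fps_X\<close> shifts coefficients; the conditionals guard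
    against truncated subtraction.\<close>
  then have coeff: "fps_nth (A * D) n = fps_nth A n
      - s * (if n = 0 then 0 else fps_nth A (n - 1))
      + t * (if n < 2 then 0 else fps_nth A (n - 2))" for n
    by (simp only: fps_add_nth fps_sub_nth fps_mult_left_const_nth fps_X_mult_nth
        fps_X_power_mult_nth)
  have "A * D = fps_const p * fps_X"
  proof (rule fps_ext)
    fix n :: nat
    consider "n = 0" | "n = 1" | m where "n = m + 2"
      by (metis One_nat_def add_2_eq_Suc' not0_implies_Suc)
    then show "fps_nth (A * D) n = fps_nth (fps_const p * fps_X) n"
    proof cases
      case 1
      then show ?thesis
        by (simp add: A_def)
    next
      case 2
      then show ?thesis
        \<comment> \<open>As A has constant term 0 and D has constant term 1, only the value p at
          index 2 survives.\<close>
        by (simp add: A_def D0 eval_nat_numeral)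
    next
      case 3
      then have "fps_nth (A * D) n = pq_fib p q (2 * m + 4)
          - s * pq_fib p q (2 * m + 2) + t * pq_fib p q (2 * m)"
        unfolding coeff by (simp add: A_def eval_nat_numeral)
      \<comment> \<open>This is the bisection recurrence at index 2m.\<close>
      also have "\<dots> = 0"
        by (simp only: pq_fib_bisection s_def t_def) simp
      finally show ?thesis
        using 3 by simp
    qed
  qed
  \<comment> \<open>Nonzero D can be cancelled in the quotient.\<close>
  moreover from D0 have "D \<noteq> 0"
    by auto
  ultimately have "A = fps_const p * fps_X / D"
    using nonzero_mult_div_cancel_right[of D A] by metis
  then show ?thesis
    by (simp only: A_def D_def s_def t_def)
qed

end
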